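(* Let $\mathsf S\in\{\mathsf T,\mathsf F\}$ and $\varphi_0,\psi_0\in\mathsf{Form}$. Then $\varphi_0\vdash_{\mathsf S}\psi_0$ if and only if $\varphi_0\vDash\psi_0$ over all finite models in $\mathsf C_{\mathsf S}$ (i.e. $\lVert\varphi_0\rVert_{\mathcal M}\subseteq\lVert\psi_0\rVert_{\mathcal M}$ for every finite $\mathcal M\in\mathsf C_{\mathsf S}$). Moreover, if $\varphi_0\nvdash_{\mathsf S}\psi_0$, there is a countermodel (a model $\mathcal M\in\mathsf C_{\mathsf S}$ with $\lVert\varphi_0\rVert_{\mathcal M}\not\subseteq\lVert\psi_0\rVert_{\mathcal M}$) with at most $4^{|\Sigma|}$ states, where $|\Sigma|\le 2\,|\mathrm{Sub}(\varphi_0)\cup\mathrm{Sub}(\psi_0)|+4$.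
   Context: **Language.** $\mathsf{Prop}$ is a countable set of propositional variables; $\mathsf{Form}$ is generated by $\varphi::=p\mid\bot\mid\top\mid(\varphi\wedge\varphi)\mid(\varphi\vee\varphi)\mid(\varphi\to\varphi)$, $p\in\mathsf{Prop}$, and $\neg\alpha:=\alpha\to\bot$. $\mathrm{Sub}(\varphi)$ is the set of subformulas of $\varphi$. **The set $\Sigma$.** $\Sigma$ is the smallest set of formulas such that (i) $\varphi_0,\psi_0,\bot,\top\in\Sigma$; (ii) $\Sigma$ is closed under subformulas; (iii) if $\alpha\to\beta\in\Sigma$ then $\alpha\wedge\beta\in\Sigma$. **Systems.** For relations ${\vdash}\subseteq\wp(\mathsf{Form})\times\mathsf{Form}$ write $\Gamma,\varphi\vdash\psi$ for $\Gamma\cup\{\varphi\}\vdash\psi$, $\varphi\vdash\psi$ for $\{\varphi\}\vdash\psi$, $\vdash\varphi$ for $\varnothing\vdash\varphi$, and $\alpha\dashv\vdash\beta$ for $\alpha\vdash\beta$ and $\beta\vdash\alpha$. The *$\mathsf K$-conditions* are, for all sets $\Gamma,\Delta$ and formulas: (A) $\Gamma,\varphi\vdash\varphi$; (Cut) if $\Gamma,\psi\vdash\varphi$ and $\Delta\vdash\psi$ then $\Gamma\cup\Delta\vdash\varphi$; ($\wedge$I) $\{\varphi,\psi\}\vdash\varphi\wedge\psi$; ($\wedge$E) $\varphi\wedge\psi\vdash\varphi$ and $\varphi\wedge\psi\vdash\psi$; ($\vee$I) $\varphi\vdash\varphi\vee\psi$ and $\psi\vdash\varphi\vee\psi$; ($\vee$E)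 if $\varphi\vdash\alpha$ and $\psi\vdash\alpha$ then $\varphi\vee\psi\vdash\alpha$; ($\bot$E) $\bot\vdash\varphi$; ($\top$) $\vdash\top$; ($\top\to$E) $\top\to\varphi\vdash\varphi$; (Con) if $\alpha\wedge\beta\vdash\psi$ then $\alpha\to\beta\vdash\alpha\to\psi$; ($\wedge{\vdash}\to$) $\alpha\wedge\beta\vdash\alpha\to\beta$; (Imp) if $\alpha\wedge\beta\vdash\varphi$ then $\varphi\to(\alpha\to\beta)\vdash(\varphi\wedge\alpha)\to\beta$; (Rep) if $\alpha\dashv\vdash\alpha'$ then $\alpha\to\beta\dashv\vdash\alpha'\to\beta$. $\vdash_{\mathsf T}$ is the smallest relation satisfying the $\mathsf K$-conditions together with ($\to$Id) $\vdash\alpha\to\alpha$ and (Exp) $\{\alpha,\neg\alpha\}\vdash\bot$. $\vdash_{\mathsf F}$ is the smallest relation satisfying all of these together with ($\neg\neg$I) $\alpha\vdash\neg\neg\alpha$. **Relational semantics.** A *relational frame* is $(X,\lhd)$ with $X\neq\varnothing$ and $\lhd$ a binary relation on $X$. For $U,V\subseteq X$: $\Box U=\{x\mid\forall y\,(y\lhd x\Rightarrow y\in U)\}$, $c_\lhd(U)=\{x\mid\forall y\,(y\lhd x\Rightarrow\exists z\,(y\lhd z\text{ and }z\in U))\}$, and $U\to_\lhd V=\{x\mid\forall y\,((y\lhd x\text{ and }y\in U)\Rightarrow\exists z\,(y\lhd z\text{ and }z\in U\cap V))\}$. A *proposition* is a fixpoint of $c_\lhd$; $\chi_\lhd(X)$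 is the set of propositions. $y$ *prerefines* $x$ if for all $z$, $z\lhd y$ implies $z\lhd x$. The frame is *reflexive* if $x\lhd x$ for all $x$, and *pseudo-symmetric* if for all $x$ and all $y\lhd x$ there is $z\lhd y$ such that $z$ prerefines $x$. An *$\mathsf F$-frame* is a reflexive, pseudo-symmetric frame. A *model* is $\mathcal M=(X,\lhd,V)$ with $(X,\lhd)$ a relational frame and $V:\mathsf{Prop}\to\chi_\lhd(X)$; it is finite if $X$ is. Truth sets: $\lVert p\rVert=V(p)$, $\lVert\top\rVert=X$, $\lVert\bot\rVert=\Box\varnothing$, $\lVert\alpha\wedge\beta\rVert=\lVert\alpha\rVert\cap\lVert\beta\rVert$, $\lVert\alpha\vee\beta\rVert=c_\lhd(\lVert\alpha\rVert\cup\lVert\beta\rVert)$, $\lVert\alpha\to\beta\rVert=\lVert\alpha\rVert\to_\lhd\lVert\beta\rVert$. $\mathsf C_{\mathsf T}$ is the class of models over reflexive frames; $\mathsf C_{\mathsf F}$ is the class of models over $\mathsf F$-frames. *)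

theory Defs
  imports "HOL-Library.Countable" "HOL-Library.Infinite_Typeclass"
begin

datatype 'p form =
    Atom 'p
  | Bot
  | Top
  | Conj "'p form" "'p form" (infixr "\<^bold>\<and>" 75)
  | Disj "'p form" "'p form" (infixr "\<^bold>\<or>" 70)
  | Imp "'p form" "'p form" (infixr "\<^bold>\<rightarrow>" 65)

abbreviation Neg :: "'p form \<Rightarrow> 'p form" ("\<^bold>\<not> _" [80] 80) where
  "\<^bold>\<not> \<alpha> \<equiv> \<alpha> \<^bold>\<rightarrow> Bot"

primrec Sub :: "'p form \<Rightarrow> 'p form set" where
  "Sub (Atom p) = {Atom p}"
| "Sub Bot = {Bot}"
| "Sub Top = {Top}"
| "Sub (\<alpha> \<^bold>\<and> \<beta>) = insert (\<alpha> \<^bold>\<and> \<beta>) (Sub \<alpha> \<union> Sub \<beta>)"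
| "Sub (\<alpha> \<^bold>\<or> \<beta>) = insert (\<alpha> \<^bold>\<or> \<beta>) (Sub \<alpha> \<union> Sub \<beta>)"
| "Sub (\<alpha> \<^bold>\<rightarrow> \<beta>) = insert (\<alpha> \<^bold>\<rightarrow> \<beta>) (Sub \<alpha> \<union> Sub \<beta>)"

inductive_set Sig :: "'p form \<Rightarrow> 'p form \<Rightarrow> 'p form set" for \<phi>\<^sub>0 \<psi>\<^sub>0 :: "'p form" where
  left: "\<phi>\<^sub>0 \<in> Sig \<phi>\<^sub>0 \<psi>\<^sub>0"
| right: "\<psi>\<^sub>0 \<in> Sig \<phi>\<^sub>0 \<psi>\<^sub>0"
| bot: "Bot \<in> Sig \<phi>\<^sub>0 \<psi>\<^sub>0"
| top: "Top \<in> Sig \<phi>\<^sub>0 \<psi>\<^sub>0"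
| sub: "\<beta> \<in> Sig \<phi>\<^sub>0 \<psi>\<^sub>0 \<Longrightarrow> \<alpha> \<in> Sub \<beta> \<Longrightarrow> \<alpha> \<in> Sig \<phi>\<^sub>0 \<psi>\<^sub>0"
| imp: "\<alpha> \<^bold>\<rightarrow> \<beta> \<in> Sig \<phi>\<^sub>0 \<psi>\<^sub>0 \<Longrightarrow> \<alpha> \<^bold>\<and> \<beta> \<in> Sig \<phi>\<^sub>0 \<psi>\<^sub>0"

datatype system = SysT | SysF

text \<open>The premise set may be infinite. In rule \<open>Rep\<close> the converse consequence
  is obtained by exchanging the two formulas \<open>\<alpha>\<close> and \<open>\<alpha>'\<close>.\<close>

inductive derives :: "system \<Rightarrow> 'p form set \<Rightarrow> 'p form \<Rightarrow> bool" for S :: system where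
  A: "derives S (\<Gamma> \<union> {\<phi>}) \<phi>"
| Cut: "derives S (\<Gamma> \<union> {\<psi>}) \<phi> \<Longrightarrow> derives S \<Delta> \<psi> \<Longrightarrow> derives S (\<Gamma> \<union> \<Delta>) \<phi>"
| ConjI: "derives S {\<phi>, \<psi>} (\<phi> \<^bold>\<and> \<psi>)"
| ConjE1: "derives S {\<phi> \<^bold>\<and> \<psi>} \<phi>"
| ConjE2: "derives S {\<phi> \<^bold>\<and> \<psi>} \<psi>"
| DisjI1: "derives S {\<phi>} (\<phi> \<^bold>\<or> \<psi>)"
| DisjI2: "derives S {\<psi>} (\<phi> \<^bold>\<or> \<psi>)"
| DisjE: "derives S {\<phi>} \<alpha> \<Longrightarrow> derives S {\<psi>} \<alpha> \<Longrightarrow> derives S {\<phi> \<^bold>\<or> \<psi>} \<alpha>"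
| BotE: "derives S {Bot} \<phi>"
| TopI: "derives S {} Top"
| TopImpE: "derives S {Top \<^bold>\<rightarrow> \<phi>} \<phi>"
| Con: "derives S {\<alpha> \<^bold>\<and> \<beta>} \<psi> \<Longrightarrow> derives S {\<alpha> \<^bold>\<rightarrow> \<beta>} (\<alpha> \<^bold>\<rightarrow> \<psi>)"
| ConjImp: "derives S {\<alpha> \<^bold>\<and> \<beta>} (\<alpha> \<^bold>\<rightarrow> \<beta>)"
| Imp: "derives S {\<alpha> \<^bold>\<and> \<beta>} \<phi> \<Longrightarrow> derives S {\<phi> \<^bold>\<rightarrow> (\<alpha> \<^bold>\<rightarrow> \<beta>)} ((\<phi> \<^bold>\<and> \<alpha>) \<^bold>\<rightarrow> \<beta>)"
| Rep: "derives S {\<alpha>} \<alpha>' \<Longrightarrow> derives S {\<alpha>'} \<alpha> \<Longrightarrow> derives S {\<alpha> \<^bold>\<rightarrow> \<beta>} (\<alpha>' \<^bold>\<rightarrow> \<beta>)"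
| ImpId: "derives S {} (\<alpha> \<^bold>\<rightarrow> \<alpha>)"
| Exp: "derives S {\<alpha>, \<^bold>\<not> \<alpha>} Bot"
| NegNegI: "S = SysF \<Longrightarrow> derives S {\<alpha>} (\<^bold>\<not> (\<^bold>\<not> \<alpha>))"

text \<open>Throughout, \<open>(y, x) \<in> R\<close> renders \<open>y \<lhd> x\<close>. As \<open>R \<subseteq> X \<times> X\<close> in every frame,
  only the outermost point of the operations below has to be restricted to \<open>X\<close>.\<close>

definition frame :: "'w set \<Rightarrow> 'w rel \<Rightarrow> bool" where
  "frame X R \<longleftrightarrow> X \<noteq> {} \<and> R \<subseteq> X \<times> X"

definition box :: "'w set \<Rightarrow> 'w rel \<Rightarrow> 'w set \<Rightarrow> 'w set" where
  "box X R U = {x \<in> X. \<forall>y. (y, x) \<in> R \<longrightarrow> y \<in> U}"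

definition clos :: "'w set \<Rightarrow> 'w rel \<Rightarrow> 'w set \<Rightarrow> 'w set" where
  "clos X R U = {x \<in> X. \<forall>y. (y, x) \<in> R \<longrightarrow> (\<exists>z. (y, z) \<in> R \<and> z \<in> U)}"

definition arrow :: "'w set \<Rightarrow> 'w rel \<Rightarrow> 'w set \<Rightarrow> 'w set \<Rightarrow> 'w set" where
  "arrow X R U V =
     {x \<in> X. \<forall>y. (y, x) \<in> R \<and> y \<in> U \<longrightarrow> (\<exists>z. (y, z) \<in> R \<and> z \<in> U \<inter> V)}"

definition propositions :: "'w set \<Rightarrow> 'w rel \<Rightarrow> 'w set set" where
  "propositions X R = {U. U \<subseteq> X \<and> clos X R U = U}"

definition prerefines :: "'w rel \<Rightarrow> 'w \<Rightarrow> 'w \<Rightarrow> bool" where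
  "prerefines R y x \<longleftrightarrow> (\<forall>z. (z, y) \<in> R \<longrightarrow> (z, x) \<in> R)"

definition pseudo_symmetric :: "'w set \<Rightarrow> 'w rel \<Rightarrow> bool" where
  "pseudo_symmetric X R \<longleftrightarrow>
     (\<forall>x\<in>X. \<forall>y. (y, x) \<in> R \<longrightarrow> (\<exists>z. (z, y) \<in> R \<and> prerefines R z x))"

text \<open>A type \<open>'w\<close> of class \<open>infinite\<close> contains an isomorphic copy of every finite model, so
  "all finite models" is rendered by quantifying over the models with finitely many states
  in an arbitrary infinite type.\<close>

record ('w, 'p) model =
  states :: "'w set"
  acc :: "'w rel"
  val :: "'p \<Rightarrow> 'w set"

definition is_model :: "('w, 'p) model \<Rightarrow> bool" where
  "is_model M \<longleftrightarrow> frame (states M) (acc M) \<and> (\<forall>p. val M p \<in> propositions (states M) (acc M))"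

primrec truth :: "('w, 'p) model \<Rightarrow> 'p form \<Rightarrow> 'w set" where
  "truth M (Atom p) = val M p"
| "truth M Top = states M"
| "truth M Bot = box (states M) (acc M) {}"
| "truth M (\<alpha> \<^bold>\<and> \<beta>) = truth M \<alpha> \<inter> truth M \<beta>"
| "truth M (\<alpha> \<^bold>\<or> \<beta>) = clos (states M) (acc M) (truth M \<alpha> \<union> truth M \<beta>)"
| "truth M (\<alpha> \<^bold>\<rightarrow> \<beta>) = arrow (states M) (acc M) (truth M \<alpha>) (truth M \<beta>)"

fun model_class :: "system \<Rightarrow> ('w, 'p) model set" where
  "model_class SysT = {M. is_model M \<and> refl_on (states M) (acc M)}"
| "model_class SysF =
     {M. is_model M \<and> refl_on (states M) (acc M) \<and> pseudo_symmetric (states M) (acc M)}"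

end

theory Submission
  imports Defs
begin

text \<open>Soundness is a rule induction: the map \<open>c\<^sub>\<lhd>\<close> of a frame is a closure operator, every truth
  set is closed under it, reflexivity validates \<open>ImpId\<close> and \<open>Exp\<close>, and pseudo-symmetry validates
  \<open>NegNegI\<close>.

  For completeness, fix the finite set \<open>\<Sigma>\<close> and write \<open>a \<le> b\<close> for derivability of \<open>b\<close> from \<open>a\<close>.
  A state is a pair \<open>(\<alpha>, \<beta>)\<close> of members of \<open>\<Sigma>\<close>. It makes true exactly what follows from \<open>\<alpha>\<close>, and
  it stands ready to falsify \<open>\<alpha> \<rightarrow> \<beta>\<close>: it is a \<open>\<lhd>\<close>-predecessor of just those states at which
  \<open>\<alpha> \<rightarrow> \<beta>\<close> is not true, so that \<open>(\<gamma>, \<delta>) \<lhd> (\<alpha>, \<beta>)\<close> means that \<open>\<alpha> \<le> \<gamma> \<rightarrow> \<delta>\<close> fails. Keeping only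
  the pairs with \<open>\<alpha> \<not>\<le> \<alpha> \<rightarrow> \<beta>\<close> makes the frame reflexive, and it loses nothing, since
  \<open>\<alpha> \<le> \<alpha> \<rightarrow> \<beta>\<close> already makes \<open>\<alpha> \<rightarrow> \<beta>\<close> a theorem (lemma \<open>imp_theorem_if_entailed\<close>).

  That a member of \<open>\<Sigma>\<close> is true at \<open>(\<alpha>, \<beta>)\<close> just in case it follows from \<open>\<alpha>\<close> (lemma \<open>truth_lemma\<close>)
  rests on two observations. If \<open>\<alpha> \<not>\<le> \<phi>\<close>, the predecessor \<open>(\<top>, \<phi>)\<close> of \<open>(\<alpha>, \<beta>)\<close> has no successor
  below \<open>\<phi>\<close>, because \<open>\<top> \<rightarrow> \<phi>\<close> is equivalent to \<open>\<phi>\<close>; if \<open>\<phi>\<close> is an implication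
  \<open>\<gamma> \<rightarrow> \<delta>\<close>, then the predecessor \<open>(\<gamma>, \<delta>)\<close> makes \<open>\<gamma>\<close> true and has no successor below \<open>\<gamma> \<and> \<delta>\<close>,
  because \<open>\<gamma> \<and> \<delta> \<le> \<gamma> \<rightarrow> \<delta>\<close>. Conversely, an implication \<open>\<gamma> \<rightarrow> \<delta>\<close> that follows from
  \<open>\<alpha>\<close> holds at \<open>(\<alpha>, \<beta>)\<close> by lemma \<open>imp_entails_imp\<close>, which condenses the rules \<open>Con\<close>, \<open>Imp\<close>
  and \<open>Rep\<close> into the one inequality that the semantics asks for; the successor that the semantics requires
  has first component \<open>\<gamma> \<and> \<delta>\<close>, and this is why \<open>\<Sigma>\<close> contains \<open>\<gamma> \<and> \<delta>\<close> along with \<open>\<gamma> \<rightarrow> \<delta>\<close>.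

  There are at most \<open>|\<Sigma>|\<^sup>2 \<le> 4\<^bsup>|\<Sigma>|\<^esup>\<close> such pairs.\<close>

section \<open>Soundness\<close>

lemma clos_increasing: "frame X R \<Longrightarrow> U \<subseteq> X \<Longrightarrow> U \<subseteq> clos X R U"
  unfolding clos_def frame_def by blast

lemma clos_mono: "U \<subseteq> V \<Longrightarrow> clos X R U \<subseteq> clos X R V"
  unfolding clos_def by blast

lemma clos_idem: "frame X R \<Longrightarrow> clos X R (clos X R U) = clos X R U"
  unfolding clos_def frame_def by blast

lemma proposition_iff:
  assumes "frame X R"
  shows "U \<in> propositions X R \<longleftrightarrow> U \<subseteq> X \<and> clos X R U \<subseteq> U"
  using clos_increasing[OF assms] unfolding propositions_def by blast

lemma clos_in_propositions: "frame X R \<Longrightarrow> clos X R U \<in> propositions X R"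
  by (simp add: propositions_def clos_idem) (simp add: clos_def)

lemma Int_in_propositions:
  assumes "frame X R" "U \<in> propositions X R" "V \<in> propositions X R"
  shows "U \<inter> V \<in> propositions X R"
  using assms clos_mono[of "U \<inter> V" U X R] clos_mono[of "U \<inter> V" V X R]
  unfolding proposition_iff[OF assms(1)] by blast

lemma box_empty_in_propositions: "frame X R \<Longrightarrow> box X R {} \<in> propositions X R"
  unfolding proposition_iff unfolding box_def clos_def by blast

lemma arrow_in_propositions: "frame X R \<Longrightarrow> arrow X R U V \<in> propositions X R"
  unfolding proposition_iff unfolding arrow_def clos_def by blast

lemma states_in_propositions: "frame X R \<Longrightarrow> X \<in> propositions X R"
  unfolding proposition_iff unfolding clos_def by blast

lemma truth_in_propositions:
  assumes "is_model M"
  shows "truth M \<phi> \<in> propositions (states M) (acc M)"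
  using assms unfolding is_model_def
  by (induction \<phi>) (auto intro: states_in_propositions box_empty_in_propositions
      Int_in_propositions clos_in_propositions arrow_in_propositions)

text \<open>Double negation introduction: if \<open>x \<in> U\<close> and \<open>y \<lhd> x\<close> forced \<open>\<not> U\<close>, then the point
  \<open>z \<lhd> y\<close> that pseudo-symmetry provides would lie in \<open>U\<close>, as it prerefines \<open>x\<close>, and would
  thereby contradict \<open>\<not> U\<close> at \<open>y\<close>.\<close>

lemma subset_arrow_arrow_empty:
  assumes "frame X R" "pseudo_symmetric X R" "U \<in> propositions X R"
  shows "U \<subseteq> arrow X R (arrow X R U (box X R {})) (box X R {})"
proof
  fix x assume x: "x \<in> U"
  have sub: "U \<subseteq> X" and cl: "clos X R U \<subseteq> U" and R: "R \<subseteq> X \<times> X"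
    using assms(1,3) proposition_iff[OF assms(1)] by (auto simp: frame_def)
  have False if y: "(y, x) \<in> R" "y \<in> arrow X R U (box X R {})" for y
  proof -
    obtain z where z: "(z, y) \<in> R" "prerefines R z x"
      using assms(2) x sub y(1) unfolding pseudo_symmetric_def by blast
    have "z \<in> clos X R U"
      using z x R unfolding clos_def prerefines_def by blast
    then show False
      using cl z(1) y(2) unfolding arrow_def box_def by blast
  qed
  then show "x \<in> arrow X R (arrow X R U (box X R {})) (box X R {})"
    using x sub unfolding arrow_def by blast
qed

text \<open>The intersection with the set of states gives the empty set of premises its meaning.\<close>

theorem soundness:
  assumes "derives S \<Gamma> \<phi>" and M: "M \<in> model_class S"
  shows "states M \<inter> (\<Inter>\<gamma>\<in>\<Gamma>. truth M \<gamma>) \<subseteq> truth M \<phi>"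
proof -
  let ?X = "states M" and ?R = "acc M"
  have model: "is_model M" and refl: "refl_on ?X ?R"
    using M by (cases S; simp)+
  have fr: "frame ?X ?R"
    using model by (simp add: is_model_def)
  have R: "(y, x) \<in> ?R \<Longrightarrow> y \<in> ?X \<and> x \<in> ?X" for x y
    using fr by (auto simp: frame_def)
  have closed: "clos ?X ?R (truth M \<phi>) = truth M \<phi>" and sub: "truth M \<phi> \<subseteq> ?X" for \<phi>
    using truth_in_propositions[OF model, of \<phi>] by (auto simp: propositions_def)
  show ?thesis
    using assms(1)
  proof (induction rule: derives.induct)
    case (DisjE \<phi> \<alpha> \<psi>)
    then have "truth M \<phi> \<union> truth M \<psi> \<subseteq> truth M \<alpha>"
      using sub by auto
    then show ?case
      using clos_mono[of "truth M \<phi> \<union> truth M \<psi>" "truth M \<alpha>" ?X ?R] closed[of \<alpha>] by auto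
  next
    case (DisjI1 \<phi> \<psi>)
    then show ?case
      using clos_increasing[OF fr, of "truth M \<phi> \<union> truth M \<psi>"] sub by auto
  next
    case (DisjI2 \<psi> \<phi>)
    then show ?case
      using clos_increasing[OF fr, of "truth M \<phi> \<union> truth M \<psi>"] sub by auto
  next
    case (BotE \<phi>)
    have "box ?X ?R {} \<subseteq> clos ?X ?R (truth M \<phi>)"
      unfolding box_def clos_def by blast
    then show ?case
      using closed[of \<phi>] by auto
  next
    case (TopImpE \<phi>)
    have "arrow ?X ?R ?X (truth M \<phi>) \<subseteq> clos ?X ?R (truth M \<phi>)"
      unfolding arrow_def clos_def using R by blast
    then show ?case
      using closed[of \<phi>] by auto
  next
    case (Con \<alpha> \<beta> \<psi>)
    then have "truth M \<alpha> \<inter> truth M \<beta> \<subseteq> truth M \<psi>"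
      using sub by auto
    then show ?case
      by (simp add: arrow_def) blast
  next
    case (ConjImp \<alpha> \<beta>)
    show ?case
      by (simp add: arrow_def) blast
  next
    case (Imp \<alpha> \<beta> \<phi>)
    then have "truth M \<alpha> \<inter> truth M \<beta> \<subseteq> truth M \<phi>"
      using sub by auto
    then show ?case
      by (simp add: arrow_def) blast
  next
    case (Rep \<alpha> \<alpha>' \<beta>)
    then have "truth M \<alpha> = truth M \<alpha>'"
      using sub by auto
    then show ?case
      by simp
  next
    case (ImpId \<alpha>)
    show ?case
      using refl R by (auto simp: arrow_def refl_on_def)
  next
    case (Exp \<alpha>)
    show ?case
      using refl by (auto simp: arrow_def refl_on_def box_def)
  next
    case (NegNegI \<alpha>)
    then have "pseudo_symmetric ?X ?R"
      using M by simp
    then show ?case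
      using subset_arrow_arrow_empty[OF fr _ truth_in_propositions[OF model, of \<alpha>]] by auto
  qed auto
qed

section \<open>Derived rules\<close>

lemma derives_weaken: "derives S \<Gamma> \<phi> \<Longrightarrow> derives S (\<Gamma> \<union> \<Delta>) \<phi>"
  using derives.Cut[OF derives.A[of S \<Delta> \<phi>], of \<Gamma>] by (simp add: Un_commute)

lemma derives_refl: "derives S {\<phi>} \<phi>"
  using derives.A[of S "{}" \<phi>] by simp

lemma derives_trans: "derives S \<Gamma> \<psi> \<Longrightarrow> derives S {\<psi>} \<phi> \<Longrightarrow> derives S \<Gamma> \<phi>"
  using derives.Cut[of S "{}" \<psi> \<phi> \<Gamma>] by simp

lemma derives_from_theorem: "derives S {} \<phi> \<Longrightarrow> derives S {\<psi>} \<phi>"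
  using derives_weaken[of S "{}" \<phi> "{\<psi>}"] by simp

lemma derives_cut2:
  assumes "derives S {\<alpha>, \<beta>} \<phi>" "derives S {\<gamma>} \<alpha>" "derives S {\<gamma>} \<beta>"
  shows "derives S {\<gamma>} \<phi>"
proof -
  have "derives S ({\<alpha>} \<union> {\<gamma>}) \<phi>"
    using assms(1) by (intro derives.Cut[OF _ assms(3)]) (simp add: insert_commute)
  then have "derives S ({\<gamma>} \<union> {\<alpha>}) \<phi>"
    by (simp only: Un_commute)
  from derives.Cut[OF this assms(2)] show ?thesis
    by simp
qed

lemma derives_conjI:
  "derives S {\<gamma>} \<alpha> \<Longrightarrow> derives S {\<gamma>} \<beta> \<Longrightarrow> derives S {\<gamma>} (\<alpha> \<^bold>\<and> \<beta>)"
  by (rule derives_cut2[OF derives.ConjI])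

lemma derives_conj_iff:
  "derives S {\<gamma>} (\<alpha> \<^bold>\<and> \<beta>) \<longleftrightarrow> derives S {\<gamma>} \<alpha> \<and> derives S {\<gamma>} \<beta>"
  using derives_conjI derives_trans[OF _ derives.ConjE1] derives_trans[OF _ derives.ConjE2]
  by blast

lemma derives_disj_left_iff:
  "derives S {\<alpha> \<^bold>\<or> \<beta>} \<gamma> \<longleftrightarrow> derives S {\<alpha>} \<gamma> \<and> derives S {\<beta>} \<gamma>"
  using derives.DisjE derives_trans[OF derives.DisjI1] derives_trans[OF derives.DisjI2]
  by blast

lemma derives_Top_imp_iff: "derives S {\<gamma>} (Top \<^bold>\<rightarrow> \<phi>) \<longleftrightarrow> derives S {\<gamma>} \<phi>"
proof
  assume "derives S {\<gamma>} \<phi>"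
  then have "derives S {\<gamma>} (Top \<^bold>\<and> \<phi>)"
    using derives_conjI derives_from_theorem derives.TopI by blast
  then show "derives S {\<gamma>} (Top \<^bold>\<rightarrow> \<phi>)"
    using derives_trans derives.ConjImp by blast
qed (rule derives_trans[OF _ derives.TopImpE])

text \<open>By \<open>Con\<close> the second hypothesis gives \<open>\<alpha> \<rightarrow> \<beta> \<le> \<alpha> \<rightarrow> (\<gamma> \<rightarrow> \<delta>)\<close>; \<open>Imp\<close> turns the right-hand
  side into \<open>(\<alpha> \<and> \<gamma>) \<rightarrow> \<delta>\<close>, whose antecedent is equivalent to \<open>\<gamma>\<close> by the first hypothesis.\<close>

lemma imp_entails_imp:
  assumes "derives S {\<gamma>} \<alpha>" "derives S {\<alpha> \<^bold>\<and> \<beta>} (\<gamma> \<^bold>\<rightarrow> \<delta>)"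
  shows "derives S {\<alpha> \<^bold>\<rightarrow> \<beta>} (\<gamma> \<^bold>\<rightarrow> \<delta>)"
proof -
  have "derives S {\<alpha> \<^bold>\<rightarrow> \<beta>} (\<alpha> \<^bold>\<rightarrow> (\<gamma> \<^bold>\<rightarrow> \<delta>))"
    by (rule derives.Con[OF assms(2)])
  moreover have "derives S {\<alpha> \<^bold>\<rightarrow> (\<gamma> \<^bold>\<rightarrow> \<delta>)} ((\<alpha> \<^bold>\<and> \<gamma>) \<^bold>\<rightarrow> \<delta>)"
    by (rule derives.Imp[OF derives_trans[OF derives.ConjE1 assms(1)]])
  moreover have "derives S {(\<alpha> \<^bold>\<and> \<gamma>) \<^bold>\<rightarrow> \<delta>} (\<gamma> \<^bold>\<rightarrow> \<delta>)"
    by (rule derives.Rep[OF derives.ConjE2 derives_conjI[OF assms(1) derives_refl]])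
  ultimately show ?thesis
    using derives_trans by blast
qed

text \<open>The instance of \<open>imp_entails_imp\<close> that has the theorem \<open>\<alpha> \<rightarrow> \<alpha>\<close> on the left.\<close>

lemma imp_theorem_if_entailed:
  assumes "derives S {\<alpha>} (\<alpha> \<^bold>\<rightarrow> \<beta>)"
  shows "derives S {} (\<alpha> \<^bold>\<rightarrow> \<beta>)"
  using derives_trans[OF derives.ImpId imp_entails_imp[OF derives_refl]]
    derives_trans[OF derives.ConjE1 assms] by blast

lemma entails_all_if_entails_Neg:
  assumes "derives S {\<alpha>} (\<^bold>\<not> \<alpha>)"
  shows "derives S {\<alpha>} \<phi>"
  using derives_cut2[OF derives.Exp derives_refl assms] derives_trans derives.BotE by blast

lemma Neg_antitone: "derives S {\<alpha>} \<beta> \<Longrightarrow> derives S {\<^bold>\<not> \<beta>} (\<^bold>\<not> \<alpha>)"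
  using imp_entails_imp derives_trans[OF derives.ConjE2 derives.BotE] by blast

lemma Neg_entails_imp: "derives S {\<^bold>\<not> \<alpha>} (\<alpha> \<^bold>\<rightarrow> \<beta>)"
  by (rule derives.Con[OF derives_trans[OF derives.ConjE2 derives.BotE]])

lemma Neg_swap:
  assumes "derives SysF {\<alpha>} (\<^bold>\<not> \<beta>)"
  shows "derives SysF {\<beta>} (\<^bold>\<not> \<alpha>)"
  using Neg_antitone[OF assms] derives_trans derives.NegNegI by blast

section \<open>The finite canonical model\<close>

lemma mem_Sub_self: "\<phi> \<in> Sub \<phi>"
  by (cases \<phi>) simp_all

definition canonical_pairs :: "system \<Rightarrow> 'p form set \<Rightarrow> ('p form \<times> 'p form) set" where
  "canonical_pairs S \<Sigma> = {(\<alpha>, \<beta>) \<in> \<Sigma> \<times> \<Sigma>. \<not> derives S {\<alpha>} (\<alpha> \<^bold>\<rightarrow> \<beta>)}"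

text \<open>The canonical pairs are named by the elements of a set \<open>W\<close> of an arbitrary type, through a
  surjection \<open>\<pi>\<close>, so that the model can live in any type with enough elements. An atom outside
  \<open>\<Sigma>\<close> may receive any proposition as its value; the set of all states is one.\<close>

definition canonical_model ::
  "system \<Rightarrow> 'p form set \<Rightarrow> 'w set \<Rightarrow> ('w \<Rightarrow> 'p form \<times> 'p form) \<Rightarrow> ('w, 'p) model" where
  "canonical_model S \<Sigma> W \<pi> =
     \<lparr>states = W,
      acc = {(y, x) \<in> W \<times> W. \<not> derives S {fst (\<pi> x)} (fst (\<pi> y) \<^bold>\<rightarrow> snd (\<pi> y))},
      val = (\<lambda>p. if Atom p \<in> \<Sigma> then {x \<in> W. derives S {fst (\<pi> x)} (Atom p)} else W)\<rparr>"

lemma states_canonical [simp]: "states (canonical_model S \<Sigma> W \<pi>) = W"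
  by (simp add: canonical_model_def)

locale canonical =
  fixes S :: system and \<Sigma> :: "'p form set" and W :: "'w set" and \<pi> :: "'w \<Rightarrow> 'p form \<times> 'p form"
  assumes pairs: "\<pi> ` W = canonical_pairs S \<Sigma>"
    and nonempty: "W \<noteq> {}"
    and Bot_mem: "Bot \<in> \<Sigma>"
    and Top_mem: "Top \<in> \<Sigma>"
    and Sub_closed: "\<beta> \<in> \<Sigma> \<Longrightarrow> \<alpha> \<in> Sub \<beta> \<Longrightarrow> \<alpha> \<in> \<Sigma>"
    and conj_mem: "\<alpha> \<^bold>\<rightarrow> \<beta> \<in> \<Sigma> \<Longrightarrow> \<alpha> \<^bold>\<and> \<beta> \<in> \<Sigma>"
begin

abbreviation "holds x \<equiv> fst (\<pi> x)"

abbreviation "target x \<equiv> fst (\<pi> x) \<^bold>\<rightarrow> snd (\<pi> x)"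

abbreviation "\<M> \<equiv> canonical_model S \<Sigma> W \<pi>"

abbreviation "R \<equiv> acc \<M>"

lemma acc_iff: "(y, x) \<in> R \<longleftrightarrow> y \<in> W \<and> x \<in> W \<and> \<not> derives S {holds x} (target y)"
  by (auto simp: canonical_model_def)

lemma not_entails_target: "x \<in> W \<Longrightarrow> \<not> derives S {holds x} (target x)"
  using imageI[of x W \<pi>] unfolding pairs by (auto simp: canonical_pairs_def split_beta mem_Times_iff)

lemma components_mem: "x \<in> W \<Longrightarrow> holds x \<in> \<Sigma> \<and> snd (\<pi> x) \<in> \<Sigma>"
  using imageI[of x W \<pi>] unfolding pairs by (auto simp: canonical_pairs_def split_beta mem_Times_iff)

lemma frame: "frame W R"
  using nonempty acc_iff by (auto simp: frame_def)

lemma refl: "refl_on W R"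
  using acc_iff not_entails_target by (auto simp: refl_on_def)

lemma obtain_state:
  assumes "\<alpha> \<in> \<Sigma>" "\<beta> \<in> \<Sigma>" "\<not> derives S {} (\<alpha> \<^bold>\<rightarrow> \<beta>)"
  obtains x where "x \<in> W" "\<pi> x = (\<alpha>, \<beta>)"
proof -
  have "(\<alpha>, \<beta>) \<in> \<pi> ` W"
    using assms imp_theorem_if_entailed pairs by (auto simp: canonical_pairs_def)
  then show ?thesis
    using that by (metis imageE)
qed

text \<open>The pair \<open>(\<alpha>, \<bottom>)\<close> serves: it is canonical unless \<open>\<alpha>\<close> is inconsistent.\<close>

lemma obtain_holds:
  assumes "\<alpha> \<in> \<Sigma>" "\<not> derives S {\<alpha>} \<phi>"
  obtains x where "x \<in> W" "\<pi> x = (\<alpha>, Bot)"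
  using assms obtain_state[OF assms(1) Bot_mem] entails_all_if_entails_Neg derives_from_theorem
  by metis

lemma obtain_refuting_imp:
  assumes "x \<in> W" "\<alpha> \<in> \<Sigma>" "\<beta> \<in> \<Sigma>" "\<not> derives S {holds x} (\<alpha> \<^bold>\<rightarrow> \<beta>)"
  obtains y where "(y, x) \<in> R" "\<pi> y = (\<alpha>, \<beta>)"
  using assms obtain_state[OF assms(2,3)] derives_from_theorem acc_iff by (metis fst_conv snd_conv)

lemma obtain_refuting:
  assumes "x \<in> W" "\<phi> \<in> \<Sigma>" "\<not> derives S {holds x} \<phi>"
  obtains y where "(y, x) \<in> R" "\<And>z. (y, z) \<in> R \<longleftrightarrow> z \<in> W \<and> \<not> derives S {holds z} \<phi>"
proof -
  obtain y where "(y, x) \<in> R" "\<pi> y = (Top, \<phi>)"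
    using obtain_refuting_imp[OF assms(1) Top_mem assms(2)] assms(3) by (auto simp: derives_Top_imp_iff)
  then show ?thesis
    by (intro that[of y]) (auto simp: acc_iff derives_Top_imp_iff)
qed

lemma entailed_in_propositions:
  assumes "\<phi> \<in> \<Sigma>"
  shows "{x \<in> W. derives S {holds x} \<phi>} \<in> propositions W R"
proof -
  have "derives S {holds x} \<phi>" if x: "x \<in> clos W R {x \<in> W. derives S {holds x} \<phi>}" for x
  proof (rule ccontr)
    assume n: "\<not> derives S {holds x} \<phi>"
    have "x \<in> W"
      using x by (simp add: clos_def)
    from this assms n obtain y
      where y: "(y, x) \<in> R" "\<And>z. (y, z) \<in> R \<longleftrightarrow> z \<in> W \<and> \<not> derives S {holds z} \<phi>"
      by (rule obtain_refuting) blast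
    from x y(1) obtain z where "(y, z) \<in> R" "derives S {holds z} \<phi>"
      by (auto simp: clos_def)
    then show False
      using y(2) by simp
  qed
  then show ?thesis
    unfolding proposition_iff[OF frame] by (auto simp: clos_def)
qed

lemma is_model: "is_model \<M>"
proof -
  have "val \<M> p \<in> propositions W R" for p
    using entailed_in_propositions[of "Atom p"] states_in_propositions[OF frame]
    by (simp add: canonical_model_def)
  then show ?thesis
    using frame by (simp add: is_model_def)
qed

text \<open>Among the states at which \<open>\<alpha>\<close> is derivable, those with first component \<open>\<alpha>\<close> make the
  least true and so are the most likely successors of \<open>y\<close>; they exist whenever \<open>\<alpha>\<close> is
  consistent, in particular if it fails to entail the target of \<open>y\<close>.\<close>

lemma successor_iff:
  assumes "y \<in> W" "\<alpha> \<in> \<Sigma>"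
  shows "(\<exists>z. (y, z) \<in> R \<and> derives S {holds z} \<alpha>) \<longleftrightarrow> \<not> derives S {\<alpha>} (target y)"
proof
  assume "\<not> derives S {\<alpha>} (target y)"
  then show "\<exists>z. (y, z) \<in> R \<and> derives S {holds z} \<alpha>"
    using obtain_holds[OF assms(2)] assms(1) acc_iff derives_refl by (metis fst_conv)
qed (use acc_iff derives_trans in blast)

lemma clos_Un_entailed:
  assumes "\<alpha> \<^bold>\<or> \<beta> \<in> \<Sigma>" "\<alpha> \<in> \<Sigma>" "\<beta> \<in> \<Sigma>"
  shows "clos W R ({x \<in> W. derives S {holds x} \<alpha>} \<union> {x \<in> W. derives S {holds x} \<beta>})
    = {x \<in> W. derives S {holds x} (\<alpha> \<^bold>\<or> \<beta>)}"
proof -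
  have "(\<exists>z. (y, z) \<in> R \<and> z \<in> {x \<in> W. derives S {holds x} \<alpha>} \<union> {x \<in> W. derives S {holds x} \<beta>})
      \<longleftrightarrow> (\<exists>z. (y, z) \<in> R \<and> z \<in> {x \<in> W. derives S {holds x} (\<alpha> \<^bold>\<or> \<beta>)})" if "y \<in> W" for y
    using successor_iff[OF that assms(1)] successor_iff[OF that assms(2)]
      successor_iff[OF that assms(3)] acc_iff derives_disj_left_iff[of S \<alpha> \<beta> "target y"] by blast
  then have "clos W R ({x \<in> W. derives S {holds x} \<alpha>} \<union> {x \<in> W. derives S {holds x} \<beta>})
    = clos W R {x \<in> W. derives S {holds x} (\<alpha> \<^bold>\<or> \<beta>)}"
    unfolding clos_def using acc_iff by blast
  then show ?thesis
    using entailed_in_propositions[OF assms(1)] by (simp add: propositions_def)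
qed

lemma arrow_entailed:
  assumes mem: "\<alpha> \<^bold>\<rightarrow> \<beta> \<in> \<Sigma>" "\<alpha> \<in> \<Sigma>" "\<beta> \<in> \<Sigma>"
  shows "arrow W R {x \<in> W. derives S {holds x} \<alpha>} {x \<in> W. derives S {holds x} \<beta>}
    = {x \<in> W. derives S {holds x} (\<alpha> \<^bold>\<rightarrow> \<beta>)}"
proof -
  have succ: "(\<exists>z. (y, z) \<in> R \<and> z \<in> {x \<in> W. derives S {holds x} \<alpha>} \<inter> {x \<in> W. derives S {holds x} \<beta>})
      \<longleftrightarrow> \<not> derives S {\<alpha> \<^bold>\<and> \<beta>} (target y)" if "y \<in> W" for y
    using successor_iff[OF that conj_mem[OF mem(1)]] acc_iff by (auto simp: derives_conj_iff)
  have "(\<forall>y. (y, x) \<in> R \<and> derives S {holds y} \<alpha> \<longrightarrow> \<not> derives S {\<alpha> \<^bold>\<and> \<beta>} (target y))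
      \<longleftrightarrow> derives S {holds x} (\<alpha> \<^bold>\<rightarrow> \<beta>)" (is "?L \<longleftrightarrow> ?R") if x: "x \<in> W" for x
  proof
    assume L: ?L
    show ?R
    proof (rule ccontr)
      assume "\<not> ?R"
      then obtain y where "(y, x) \<in> R" "\<pi> y = (\<alpha>, \<beta>)"
        using obtain_refuting_imp[OF x mem(2,3)] by blast
      then show False
        using L[rule_format, of y] derives.ConjImp[of S \<alpha> \<beta>] derives_refl[of S \<alpha>] by simp
    qed
  next
    assume ?R
    then show ?L
      using imp_entails_imp derives_trans acc_iff by blast
  qed
  then show ?thesis
    unfolding arrow_def using succ acc_iff by blast
qed

lemma truth_lemma:
  "\<phi> \<in> \<Sigma> \<Longrightarrow> truth \<M> \<phi> = {x \<in> W. derives S {holds x} \<phi>}"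
proof (induction \<phi>)
  case (Atom p)
  then show ?case
    by (simp add: canonical_model_def)
next
  case Bot
  have "derives S {holds x} Bot \<longleftrightarrow> (\<forall>y. (y, x) \<notin> R)" if "x \<in> W" for x
    using obtain_refuting[OF that Bot_mem] acc_iff derives_trans[OF _ derives.BotE] by metis
  then show ?case
    by (auto simp: box_def)
next
  case Top
  show ?case
    by (auto intro: derives_from_theorem derives.TopI)
next
  case (Conj \<phi> \<psi>)
  have "\<phi> \<in> \<Sigma>" "\<psi> \<in> \<Sigma>"
    using Sub_closed[OF Conj.prems] mem_Sub_self by auto
  then show ?case
    using Conj.IH by (auto simp: derives_conj_iff)
next
  case (Disj \<phi> \<psi>)
  have "\<phi> \<in> \<Sigma>" "\<psi> \<in> \<Sigma>"
    using Sub_closed[OF Disj.prems] mem_Sub_self by auto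
  then show ?case
    using Disj.IH clos_Un_entailed[OF Disj.prems] by simp
next
  case (Imp \<phi> \<psi>)
  have "\<phi> \<in> \<Sigma>" "\<psi> \<in> \<Sigma>"
    using Sub_closed[OF Imp.prems] mem_Sub_self by auto
  then show ?case
    using Imp.IH arrow_entailed[OF Imp.prems] by simp
qed

text \<open>For \<open>y \<lhd> x\<close> with \<open>\<alpha>\<close> the first component of \<open>x\<close>, the pair \<open>(\<alpha>, \<bottom>)\<close> prerefines \<open>x\<close>, as
  the predecessors of a state depend on its first component alone. It precedes \<open>y\<close>, as otherwise
  \<open>\<not> \<alpha>\<close> would follow from the first component of \<open>y\<close>, and exchanging the two formulas would make
  the target of \<open>y\<close> follow from \<open>\<alpha>\<close>.\<close>

lemma pseudo_symmetric:
  assumes F: "S = SysF"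
  shows "pseudo_symmetric W R"
  unfolding pseudo_symmetric_def
proof (intro ballI allI impI)
  fix x y assume "x \<in> W" and yx: "(y, x) \<in> R"
  then have W: "x \<in> W" "y \<in> W" and n: "\<not> derives S {holds x} (target y)"
    using acc_iff by auto
  obtain z where z: "z \<in> W" "\<pi> z = (holds x, Bot)"
    using obtain_holds[OF _ n] components_mem[OF W(1)] by blast
  have "\<not> derives S {holds y} (\<^bold>\<not> holds x)"
    using n F Neg_swap derives_trans[OF _ Neg_entails_imp] by metis
  then have "(z, y) \<in> R"
    using z W acc_iff by simp
  moreover have "prerefines R z x"
    using z W acc_iff by (simp add: prerefines_def)
  ultimately show "\<exists>z. (z, y) \<in> R \<and> prerefines R z x"
    by blast
qed

lemma in_model_class: "\<M> \<in> model_class S"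
  using is_model refl pseudo_symmetric by (cases S) simp_all

text \<open>The state \<open>(\<phi>, \<bottom>)\<close> separates \<open>\<phi>\<close> from every member of \<open>\<Sigma>\<close> that it does not entail.\<close>

lemma countermodel:
  assumes "\<phi> \<in> \<Sigma>" "\<psi> \<in> \<Sigma>" "\<not> derives S {\<phi>} \<psi>"
  shows "\<not> truth \<M> \<phi> \<subseteq> truth \<M> \<psi>"
proof -
  obtain x where "x \<in> W" "holds x = \<phi>"
    using obtain_holds[OF assms(1,3)] by (metis fst_conv)
  then show ?thesis
    using assms truth_lemma derives_refl by fastforce
qed

end

lemma canonical_pairs_subset: "canonical_pairs S \<Sigma> \<subseteq> \<Sigma> \<times> \<Sigma>"
  by (auto simp: canonical_pairs_def)

section \<open>The size of \<open>\<Sigma>\<close>\<close>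

lemma finite_Sub: "finite (Sub \<phi>)"
  by (induction \<phi>) auto

lemma Sub_trans: "\<beta> \<in> Sub \<gamma> \<Longrightarrow> \<alpha> \<in> Sub \<beta> \<Longrightarrow> \<alpha> \<in> Sub \<gamma>"
  by (induction \<gamma>) auto

text \<open>Closing under subformulas and then adding one conjunction per implication suffices: the
  proper subformulas of the added conjunctions are present already, and no implication is new.\<close>

lemma Sig_subset:
  fixes \<phi>\<^sub>0 \<psi>\<^sub>0 :: "'p form"
  defines "B \<equiv> Sub \<phi>\<^sub>0 \<union> Sub \<psi>\<^sub>0"
  shows "Sig \<phi>\<^sub>0 \<psi>\<^sub>0 \<subseteq> B \<union> {\<alpha> \<^bold>\<and> \<beta> |\<alpha> \<beta>. \<alpha> \<^bold>\<rightarrow> \<beta> \<in> B} \<union> {Bot, Top}"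
proof
  fix \<phi> assume "\<phi> \<in> Sig \<phi>\<^sub>0 \<psi>\<^sub>0"
  then show "\<phi> \<in> B \<union> {\<alpha> \<^bold>\<and> \<beta> |\<alpha> \<beta>. \<alpha> \<^bold>\<rightarrow> \<beta> \<in> B} \<union> {Bot, Top}"
  proof induction
    case (sub \<beta> \<alpha>)
    have closed: "\<gamma> \<in> B \<Longrightarrow> \<alpha> \<in> Sub \<gamma> \<Longrightarrow> \<alpha> \<in> B" for \<alpha> \<gamma>
      using Sub_trans by (auto simp: B_def)
    consider "\<beta> \<in> B" | \<gamma> \<delta> where "\<beta> = \<gamma> \<^bold>\<and> \<delta>" "\<gamma> \<^bold>\<rightarrow> \<delta> \<in> B" | "\<beta> = Bot" | "\<beta> = Top"
      using sub.IH by blast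
    then show ?case
    proof cases
      case 2
      then show ?thesis
        using sub.hyps(2) closed[OF 2(2), of \<alpha>] by auto
    qed (use sub.hyps(2) closed in auto)
  qed (auto simp: B_def mem_Sub_self)
qed

lemma Sig_size:
  "finite (Sig \<phi>\<^sub>0 \<psi>\<^sub>0) \<and> card (Sig \<phi>\<^sub>0 \<psi>\<^sub>0) \<le> 2 * card (Sub \<phi>\<^sub>0 \<union> Sub \<psi>\<^sub>0) + 2"
proof -
  let ?B = "Sub \<phi>\<^sub>0 \<union> Sub \<psi>\<^sub>0"
  let ?C = "{\<alpha> \<^bold>\<and> \<beta> |\<alpha> \<beta>. \<alpha> \<^bold>\<rightarrow> \<beta> \<in> ?B}"
  let ?conj = "\<lambda>\<phi>. case \<phi> of Imp \<alpha> \<beta> \<Rightarrow> \<alpha> \<^bold>\<and> \<beta> | _ \<Rightarrow> \<phi>"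
  have B: "finite ?B"
    by (simp add: finite_Sub)
  have C: "?C \<subseteq> ?conj ` ?B"
  proof
    fix \<phi> assume "\<phi> \<in> ?C"
    then obtain \<alpha> \<beta> where "\<phi> = \<alpha> \<^bold>\<and> \<beta>" "\<alpha> \<^bold>\<rightarrow> \<beta> \<in> ?B"
      by blast
    then show "\<phi> \<in> ?conj ` ?B"
      by (intro rev_image_eqI[of "\<alpha> \<^bold>\<rightarrow> \<beta>"]) simp_all
  qed
  have finC: "finite ?C"
    by (rule finite_surj[OF B C])
  have cardC: "card ?C \<le> card ?B"
    by (rule surj_card_le[OF B C])
  have "card (Sig \<phi>\<^sub>0 \<psi>\<^sub>0) \<le> card (?B \<union> ?C \<union> {Bot, Top})"
    using B finC by (intro card_mono Sig_subset) simp
  also have "\<dots> \<le> card (?B \<union> ?C) + card {Bot, Top :: 'a form}"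
    by (rule card_Un_le)
  also have "\<dots> \<le> card ?B + card ?C + 2"
    using card_Un_le[of ?B ?C] by simp
  finally have "card (Sig \<phi>\<^sub>0 \<psi>\<^sub>0) \<le> 2 * card ?B + 2"
    using cardC by linarith
  moreover have "finite (Sig \<phi>\<^sub>0 \<psi>\<^sub>0)"
    using B finC by (intro finite_subset[OF Sig_subset]) simp
  ultimately show ?thesis
    by blast
qed

section \<open>Completeness and the finite model property\<close>

theorem finite_countermodel:
  fixes \<phi>\<^sub>0 \<psi>\<^sub>0 :: "'p form"
  assumes nd: "\<not> derives S {\<phi>\<^sub>0} \<psi>\<^sub>0"
  obtains M :: "('w::infinite, 'p) model"
  where "M \<in> model_class S" "\<not> truth M \<phi>\<^sub>0 \<subseteq> truth M \<psi>\<^sub>0"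
    "finite (states M)" "card (states M) \<le> card (Sig \<phi>\<^sub>0 \<psi>\<^sub>0) ^ 2"
proof -
  let ?S = "Sig \<phi>\<^sub>0 \<psi>\<^sub>0"
  let ?P = "canonical_pairs S ?S"
  have finS: "finite ?S"
    using Sig_size by blast
  have finP: "finite ?P"
    using finite_subset[OF canonical_pairs_subset] finS by blast
  have cardP: "card ?P \<le> card ?S ^ 2"
    using card_mono[OF _ canonical_pairs_subset, of ?S S] finS
    by (simp add: card_cartesian_product power2_eq_square)
  obtain W :: "'w set" where W: "finite W" "card W = card ?P"
    using infinite_arbitrarily_large[OF infinite_UNIV] by blast
  then obtain \<pi> where \<pi>: "bij_betw \<pi> W ?P"
    using finP finite_same_card_bij by metis
  have "\<not> derives S {\<phi>\<^sub>0} (\<phi>\<^sub>0 \<^bold>\<rightarrow> Bot)"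
    using nd entails_all_if_entails_Neg by blast
  then have "(\<phi>\<^sub>0, Bot) \<in> ?P"
    by (simp add: canonical_pairs_def Sig.left Sig.bot)
  then have "W \<noteq> {}"
    using \<pi> by (auto simp: bij_betw_def)
  then interpret canonical S ?S W \<pi>
    using \<pi> by unfold_locales (auto simp: bij_betw_def intro: Sig.intros)
  show ?thesis
    using that[of "canonical_model S ?S W \<pi>"] in_model_class W cardP
      countermodel[OF Sig.left Sig.right nd] by simp
qed

lemma square_le_four_power: "n ^ 2 \<le> (4 :: nat) ^ n"
proof -
  have "n ^ 2 \<le> (2 ^ n) ^ 2"
    by (intro power_mono) (simp_all add: less_imp_le[OF less_exp])
  also have "\<dots> = 4 ^ n"
    by (simp add: power_even_eq[symmetric] power_mult[symmetric] mult.commute[of n 2] power_mult)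
  finally show ?thesis .
qed

theorem theorem6p10:
  fixes S :: system and \<phi>\<^sub>0 \<psi>\<^sub>0 :: "'p::countable form"
  shows
    "(derives S {\<phi>\<^sub>0} \<psi>\<^sub>0 \<longleftrightarrow>
        (\<forall>M :: ('w::infinite, 'p) model. M \<in> model_class S \<and> finite (states M) \<longrightarrow>
           truth M \<phi>\<^sub>0 \<subseteq> truth M \<psi>\<^sub>0)) \<and>
     (\<not> derives S {\<phi>\<^sub>0} \<psi>\<^sub>0 \<longrightarrow>
        (\<exists>M :: ('w, 'p) model. M \<in> model_class S \<and> \<not> truth M \<phi>\<^sub>0 \<subseteq> truth M \<psi>\<^sub>0 \<and>
           finite (states M) \<and> card (states M) \<le> 4 ^ card (Sig \<phi>\<^sub>0 \<psi>\<^sub>0))) \<and>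
     finite (Sig \<phi>\<^sub>0 \<psi>\<^sub>0) \<and>
     card (Sig \<phi>\<^sub>0 \<psi>\<^sub>0) \<le> 2 * card (Sub \<phi>\<^sub>0 \<union> Sub \<psi>\<^sub>0) + 4"
proof -
  have sound: "truth M \<phi>\<^sub>0 \<subseteq> truth M \<psi>\<^sub>0"
    if "derives S {\<phi>\<^sub>0} \<psi>\<^sub>0" "M \<in> model_class S" for M :: "('w, 'p) model"
  proof -
    have "is_model M"
      using that(2) by (cases S) simp_all
    then have "truth M \<phi>\<^sub>0 \<subseteq> states M"
      using truth_in_propositions by (auto simp: propositions_def)
    then show ?thesis
      using soundness[OF that] by auto
  qed
  have counter: "\<exists>M :: ('w, 'p) model. M \<in> model_class S \<and> \<not> truth M \<phi>\<^sub>0 \<subseteq> truth M \<psi>\<^sub>0 \<and>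
      finite (states M) \<and> card (states M) \<le> 4 ^ card (Sig \<phi>\<^sub>0 \<psi>\<^sub>0)"
    if nd: "\<not> derives S {\<phi>\<^sub>0} \<psi>\<^sub>0"
  proof -
    obtain M :: "('w, 'p) model" where "M \<in> model_class S" "\<not> truth M \<phi>\<^sub>0 \<subseteq> truth M \<psi>\<^sub>0"
      "finite (states M)" "card (states M) \<le> card (Sig \<phi>\<^sub>0 \<psi>\<^sub>0) ^ 2"
      by (rule finite_countermodel[OF nd])
    then show ?thesis
      using square_le_four_power[of "card (Sig \<phi>\<^sub>0 \<psi>\<^sub>0)"] by (meson le_trans)
  qed
  show ?thesis
    using sound counter Sig_size[of \<phi>\<^sub>0 \<psi>\<^sub>0] by (intro conjI impI iffI allI) (blast | linarith)+
qed

end
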